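(* Let $G$ be a simply connected solvable real Lie group of dimension four, with Lie algebra $\mathfrak g$ written as in the list in the context, with basis $e_1,\dots,e_4$ and dual basis $e^1,\dots,e^4$ of $\mathfrak g^*$; write $e^{ij}=e^i\wedge e^j$. Then the following list gives the cases where there exists a left invariant symplectic structure $\omega$ on $G$, together with the general form of such an $\omega$, with real coefficients subject to the stated condition. 1. $\mathfrak{rh}_3$: $\omega=a_{12}e^{12}+a_{13}e^{13}+a_{14}e^{14}+a_{23}e^{23}+a_{24}e^{24}$, $a_{14}a_{23}-a_{13}a_{24}\neq0$. 2. $\mathfrak{rr}_{3,0}$: $\omega=a_{12}e^{12}+a_{13}e^{13}+a_{14}e^{14}+a_{34}e^{34}$, $a_{12}a_{34}\neq0$. 3. $\mathfrak{rr}_{3,-1}$: $\omega=a_{12}e^{12}+a_{13}e^{13}+a_{14}e^{14}+a_{23}e^{23}$, $a_{14}a_{23}\neq0$. 4. $\mathfrak{rr}'_{3,0}$: $\omega=a_{12}e^{12}+a_{13}e^{13}+a_{14}e^{14}+a_{23}e^{23}$, $a_{14}a_{23}\neq0$. 5. $\mathfrak r_2\mathfrak r_2$: $\omega=a_{12}e^{12}+a_{13}e^{13}+a_{34}e^{34}$, $a_{12}a_{34}\neq0$. 6. $\mathfrak r_2'$: $\omega=a_{12}e^{12}+a(e^{13}-e^{24})+b(e^{14}+e^{23})$, $a^2+b^2\neq0$. 7. $\mathfrak n_4$: $\omega=a_{12}e^{12}+a_{14}e^{14}+a_{24}e^{24}+a_{34}e^{34}$, $a_{12}a_{34}\neq0$.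 8. $\mathfrak r_{4,0}$: $\omega=a_{14}e^{14}+a_{23}e^{23}+a_{24}e^{24}+a_{34}e^{34}$, $a_{14}a_{23}\neq0$. 9. $\mathfrak r_{4,-1}$: $\omega=a_{13}e^{13}+a_{14}e^{14}+a_{24}e^{24}+a_{34}e^{34}$, $a_{13}a_{24}\neq0$. 10. $\mathfrak r_{4,-1,\beta}$, $\beta\neq-1,0,1$: $\omega=a_{12}e^{12}+a_{14}e^{14}+a_{24}e^{24}+a_{34}e^{34}$, $a_{12}a_{34}\neq0$. 11. $\mathfrak r_{4,-1,-1}$: $\omega=a_{12}e^{12}+a_{13}e^{13}+a_{14}e^{14}+a_{24}e^{24}+a_{34}e^{34}$, $a_{12}a_{34}-a_{13}a_{24}\neq0$. 12. $\mathfrak r_{4,-1,1}$: $\omega=a_{12}e^{12}+a_{14}e^{14}+a_{23}e^{23}+a_{24}e^{24}+a_{34}e^{34}$, $a_{12}a_{34}+a_{14}a_{23}\neq0$. 13. $\mathfrak r_{4,\alpha,-\alpha}$, $\alpha\neq-1,0$: $\omega=a_{14}e^{14}+a_{23}e^{23}+a_{24}e^{24}+a_{34}e^{34}$, $a_{14}a_{23}\neq0$. 14. $\mathfrak r'_{4,0,\delta}$, $\delta\neq0$: $\omega=a_{14}e^{14}+a_{23}e^{23}+a_{24}e^{24}+a_{34}e^{34}$, $a_{14}a_{23}\neq0$. 15. $\mathfrak d_{4,1}$: $\omega=a(e^{12}-e^{34})+a_{14}e^{14}+a_{24}e^{24}$, $a\neq0$. 16. $\mathfrak d_{4,2}$: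 $\omega=a(e^{12}-e^{34})+a_{14}e^{14}+a_{23}e^{23}+a_{24}e^{24}$, $a^2+a_{14}a_{23}\neq0$. 17. $\mathfrak d_{4,\lambda}$, $\lambda\neq1,2$: $\omega=a(e^{12}-e^{34})+a_{14}e^{14}+a_{24}e^{24}$, $a\neq0$. 18. $\mathfrak d'_{4,\delta}$, $\delta\neq0$: $\omega=a(-e^{12}+\delta e^{34})+a_{14}e^{14}+a_{24}e^{24}$, $a\neq0$. 19. $\mathfrak h_4$: $\omega=a(e^{12}-e^{34})+a_{14}e^{14}+a_{24}e^{24}$, $a\neq0$.
   Context: A left invariant symplectic structure on $G$ is identified with a 2-form $\omega\in\Lambda^2\mathfrak g^*$ that is closed ($d\omega=0$) and non-degenerate ($\omega\wedge\omega\neq0$), where $d$ is the exterior derivative on left invariant forms, determined by $d\theta(X,Y)=-\theta([X,Y])$ for $\theta\in\mathfrak g^*$ and the graded Leibniz rule. List of Lie algebras: every four-dimensional solvable real Lie algebra is isomorphic to one and only one of the following, with basis $e_1,\dots,e_4$; brackets of basis vectors not determined by those listed (via antisymmetry) are zero. $\mathfrak a_4$: abelian. $\mathfrak{rh}_3$: $[e_1,e_2]=e_3$. $\mathfrak{rr}_3$: $[e_1,e_2]=e_2$, $[e_1,e_3]=e_2+e_3$. $\mathfrak{rr}_{3,\lambda}$, $\lambda\in[-1,1]$: $[e_1,e_2]=e_2$, $[e_1,e_3]=\lambda e_3$. $\mathfrak{rr}'_{3,\gamma}$, $\gamma\ge0$: $[e_1,e_2]=\gamma e_2-e_3$, $[e_1,e_3]=e_2+\gamma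 e_3$. $\mathfrak r_2\mathfrak r_2$: $[e_1,e_2]=e_2$, $[e_3,e_4]=e_4$. $\mathfrak r_2'$: $[e_1,e_3]=e_3$, $[e_1,e_4]=e_4$, $[e_2,e_3]=e_4$, $[e_2,e_4]=-e_3$. $\mathfrak n_4$: $[e_4,e_1]=e_2$, $[e_4,e_2]=e_3$. $\mathfrak r_4$: $[e_4,e_1]=e_1$, $[e_4,e_2]=e_1+e_2$, $[e_4,e_3]=e_2+e_3$. $\mathfrak r_{4,\mu}$, $\mu\in\mathbb R$: $[e_4,e_1]=e_1$, $[e_4,e_2]=\mu e_2$, $[e_4,e_3]=e_2+\mu e_3$. $\mathfrak r_{4,\alpha,\beta}$, $\alpha\beta\ne0$, $-1\le\alpha\le\beta\le1$: $[e_4,e_1]=e_1$, $[e_4,e_2]=\alpha e_2$, $[e_4,e_3]=\beta e_3$. $\mathfrak r'_{4,\gamma,\delta}$, $\gamma\in\mathbb R$, $\delta>0$: $[e_4,e_1]=e_1$, $[e_4,e_2]=\gamma e_2-\delta e_3$, $[e_4,e_3]=\delta e_2+\gamma e_3$. $\mathfrak d_4$: $[e_1,e_2]=e_3$, $[e_4,e_1]=e_1$, $[e_4,e_2]=-e_2$. $\mathfrak d_{4,\lambda}$, $\lambda\ge\frac12$: $[e_1,e_2]=e_3$, $[e_4,e_3]=e_3$, $[e_4,e_1]=\lambda e_1$, $[e_4,e_2]=(1-\lambda)e_2$. $\mathfrak d'_{4,\delta}$, $\delta\ge0$: $[e_1,e_2]=e_3$, $[e_4,e_1]=\frac\delta2e_1-e_2$,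 $[e_4,e_3]=\delta e_3$, $[e_4,e_2]=e_1+\frac\delta2e_2$. $\mathfrak h_4$: $[e_1,e_2]=e_3$, $[e_4,e_3]=e_3$, $[e_4,e_1]=\frac12e_1$, $[e_4,e_2]=e_1+\frac12e_2$.
   Formalization: In item 16 the condition is corrected to a² − a14·a23 ≠ 0 (with the printed plus sign, a = a14 = a23 = 1 is degenerate), and the abelian algebra a_4, which carries symplectic forms such as e12+e34, is added to the list of cases where a symplectic structure exists. *)

theory Defs
  imports "HOL-Analysis.Analysis"
begin

section \<open>Real Lie algebras\<close>

definition lie_bracket :: "('a::real_vector \<Rightarrow> 'a \<Rightarrow> 'a) \<Rightarrow> bool" where
  "lie_bracket br \<longleftrightarrow> bilinear br \<and> (\<forall>x. br x x = 0) \<and>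
     (\<forall>x y z. br x (br y z) + br y (br z x) + br z (br x y) = 0)"

fun derived_series :: "('a::real_vector \<Rightarrow> 'a \<Rightarrow> 'a) \<Rightarrow> nat \<Rightarrow> 'a set" where
  "derived_series br 0 = UNIV"
| "derived_series br (Suc n) =
     span {br x y | x y. x \<in> derived_series br n \<and> y \<in> derived_series br n}"

definition lie_solvable :: "('a::real_vector \<Rightarrow> 'a \<Rightarrow> 'a) \<Rightarrow> bool" where
  "lie_solvable br \<longleftrightarrow> (\<exists>n. derived_series br n = {0})"

definition basis4 :: "(nat \<Rightarrow> 'a::real_vector) \<Rightarrow> bool" where
  "basis4 e \<longleftrightarrow> inj_on e {1..4} \<and> independent (e ` {1..4}) \<and> span (e ` {1..4}) = UNIV"

definition dual_basis :: "(nat \<Rightarrow> 'a::real_vector) \<Rightarrow> nat \<Rightarrow> 'a \<Rightarrow> real" where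
  "dual_basis e i x = representation (e ` {1..4}) x (e i)"


section \<open>Left invariant forms\<close>

text \<open>A form of degree \<open>k\<close> on the Lie algebra is a curried alternating function of \<open>k\<close>
  vectors.  The wedge products are sums over shuffles, without combinatorial factors, so that
  \<open>(\<theta> \<and> \<eta>)(X, Y) = \<theta>(X) \<eta>(Y) - \<theta>(Y) \<eta>(X)\<close>; this is the normalisation compatible with
  \<open>d\<theta>(X, Y) = -\<theta>([X, Y])\<close>.\<close>

definition two_form :: "('a::real_vector \<Rightarrow> 'a \<Rightarrow> real) \<Rightarrow> bool" where
  "two_form \<omega> \<longleftrightarrow> bilinear \<omega> \<and> (\<forall>X. \<omega> X X = 0)"

definition wedge_1_1 :: "('a \<Rightarrow> real) \<Rightarrow> ('a \<Rightarrow> real) \<Rightarrow> 'a \<Rightarrow> 'a \<Rightarrow> real" where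
  "wedge_1_1 \<theta> \<eta> = (\<lambda>X Y. \<theta> X * \<eta> Y - \<theta> Y * \<eta> X)"

definition wedge_2_1 :: "('a \<Rightarrow> 'a \<Rightarrow> real) \<Rightarrow> ('a \<Rightarrow> real) \<Rightarrow> 'a \<Rightarrow> 'a \<Rightarrow> 'a \<Rightarrow> real" where
  "wedge_2_1 \<phi> \<theta> = (\<lambda>X Y Z. \<phi> X Y * \<theta> Z - \<phi> X Z * \<theta> Y + \<phi> Y Z * \<theta> X)"

definition wedge_1_2 :: "('a \<Rightarrow> real) \<Rightarrow> ('a \<Rightarrow> 'a \<Rightarrow> real) \<Rightarrow> 'a \<Rightarrow> 'a \<Rightarrow> 'a \<Rightarrow> real" where
  "wedge_1_2 \<theta> \<phi> = (\<lambda>X Y Z. \<theta> X * \<phi> Y Z - \<theta> Y * \<phi> X Z + \<theta> Z * \<phi> X Y)"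

definition wedge_2_2 ::
  "('a \<Rightarrow> 'a \<Rightarrow> real) \<Rightarrow> ('a \<Rightarrow> 'a \<Rightarrow> real) \<Rightarrow> 'a \<Rightarrow> 'a \<Rightarrow> 'a \<Rightarrow> 'a \<Rightarrow> real" where
  "wedge_2_2 \<phi> \<psi> = (\<lambda>X Y Z W.
     \<phi> X Y * \<psi> Z W - \<phi> X Z * \<psi> Y W + \<phi> X W * \<psi> Y Z
     + \<phi> Y Z * \<psi> X W - \<phi> Y W * \<psi> X Z + \<phi> Z W * \<psi> X Y)"

definition ext_d1 :: "('a \<Rightarrow> 'a \<Rightarrow> 'a) \<Rightarrow> ('a \<Rightarrow> real) \<Rightarrow> 'a \<Rightarrow> 'a \<Rightarrow> real" where
  "ext_d1 br \<theta> = (\<lambda>X Y. - \<theta> (br X Y))"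

definition is_ext_d2 :: "('a::real_vector \<Rightarrow> 'a \<Rightarrow> 'a) \<Rightarrow>
    (('a \<Rightarrow> 'a \<Rightarrow> real) \<Rightarrow> 'a \<Rightarrow> 'a \<Rightarrow> 'a \<Rightarrow> real) \<Rightarrow> bool" where
  "is_ext_d2 br D \<longleftrightarrow>
     (\<forall>\<phi> \<psi> a b. two_form \<phi> \<longrightarrow> two_form \<psi> \<longrightarrow>
        D (\<lambda>X Y. a * \<phi> X Y + b * \<psi> X Y) = (\<lambda>X Y Z. a * D \<phi> X Y Z + b * D \<psi> X Y Z)) \<and>
     (\<forall>\<theta> \<eta>. linear \<theta> \<longrightarrow> linear \<eta> \<longrightarrow>
        D (wedge_1_1 \<theta> \<eta>) =
          (\<lambda>X Y Z. wedge_2_1 (ext_d1 br \<theta>) \<eta> X Y Z - wedge_1_2 \<theta> (ext_d1 br \<eta>) X Y Z))"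

text \<open>In finite dimension every 2-form is a sum of products of 1-forms, so the conditions
  above determine \<open>D\<close> on 2-forms; the choice only affects its irrelevant values elsewhere
  (see \<open>ext_d2_eq\<close> below).\<close>

definition ext_d2 :: "('a::real_vector \<Rightarrow> 'a \<Rightarrow> 'a) \<Rightarrow>
    ('a \<Rightarrow> 'a \<Rightarrow> real) \<Rightarrow> 'a \<Rightarrow> 'a \<Rightarrow> 'a \<Rightarrow> real" where
  "ext_d2 br = (SOME D. is_ext_d2 br D)"

definition symplectic_form :: "('a::real_vector \<Rightarrow> 'a \<Rightarrow> 'a) \<Rightarrow> ('a \<Rightarrow> 'a \<Rightarrow> real) \<Rightarrow> bool" where
  "symplectic_form br \<omega> \<longleftrightarrow>
     two_form \<omega> \<and> ext_d2 br \<omega> = (\<lambda>X Y Z. 0) \<and> wedge_2_2 \<omega> \<omega> \<noteq> (\<lambda>X Y Z W. 0)"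

text \<open>For \<open>\<omega> = \<Sum> a\<^sub>i\<^sub>j e\<^sup>i\<^sup>j\<close> one has
  \<open>\<omega> \<and> \<omega> = 2 (a\<^sub>1\<^sub>2 a\<^sub>3\<^sub>4 - a\<^sub>1\<^sub>3 a\<^sub>2\<^sub>4 + a\<^sub>1\<^sub>4 a\<^sub>2\<^sub>3) e\<^sup>1\<^sup>2\<^sup>3\<^sup>4\<close>.
  In particular \<open>a (e\<^sup>1\<^sup>2 - e\<^sup>3\<^sup>4) + a\<^sub>1\<^sub>4 e\<^sup>1\<^sup>4 + a\<^sub>2\<^sub>3 e\<^sup>2\<^sup>3 + a\<^sub>2\<^sub>4 e\<^sup>2\<^sup>4\<close>, the form occurring for
  the algebra \<open>D4_par 2\<close>, is non-degenerate iff \<open>a\<^sup>2 - a\<^sub>1\<^sub>4 a\<^sub>2\<^sub>3 \<noteq> 0\<close>; the sign in the published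
  condition \<open>a\<^sup>2 + a\<^sub>1\<^sub>4 a\<^sub>2\<^sub>3 \<noteq> 0\<close> is a misprint (take \<open>a = a\<^sub>1\<^sub>4 = a\<^sub>2\<^sub>3 = 1\<close>).\<close>

lemma two_form_skew:
  assumes "two_form \<omega>" shows "\<omega> Y X = - \<omega> X Y"
proof -
  have b: "bilinear \<omega>" and a: "\<And>X. \<omega> X X = 0"
    using assms by (auto simp: two_form_def)
  have "\<omega> (X + Y) (X + Y) = \<omega> X X + \<omega> X Y + (\<omega> Y X + \<omega> Y Y)"
    by (simp add: bilinear_ladd[OF b] bilinear_radd[OF b])
  then show ?thesis by (simp add: a)
qed

lemma basis4_expansion:
  assumes "basis4 e"
  shows "X = dual_basis e 1 X *\<^sub>R e 1 + dual_basis e 2 X *\<^sub>R e 2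
           + dual_basis e 3 X *\<^sub>R e 3 + dual_basis e 4 X *\<^sub>R e 4"
proof -
  have inj: "inj_on e {1..4}" and ind: "independent (e ` {1..4})"
    and sp: "span (e ` {1..4}) = UNIV"
    using assms by (auto simp: basis4_def)
  have "X = (\<Sum>b\<in>e ` {1..4}. representation (e ` {1..4}) X b *\<^sub>R b)"
    by (rule sum_representation_eq[symmetric]) (use ind sp in auto)
  also have "\<dots> = (\<Sum>i\<in>{1..4}. dual_basis e i X *\<^sub>R e i)"
    by (simp add: sum.reindex[OF inj] dual_basis_def del: One_nat_def)
  also have "{1..4} = {1, 2, 3, 4::nat}" by auto
  finally show ?thesis by (simp add: add.assoc)
qed

lemma linear_dual_basis:
  assumes "basis4 e" shows "linear (dual_basis e i)"
proof -
  have "independent (e ` {1..4})" "span (e ` {1..4}) = UNIV"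
    using assms by (auto simp: basis4_def)
  then show ?thesis
    by (intro linearI) (simp_all add: dual_basis_def representation_add representation_scale)
qed

lemma two_form_basis_expansion:
  assumes "basis4 e" "two_form \<omega>"
  shows "\<omega> = (\<lambda>X Y.
      \<omega> (e 1) (e 2) * wedge_1_1 (dual_basis e 1) (dual_basis e 2) X Y
    + \<omega> (e 1) (e 3) * wedge_1_1 (dual_basis e 1) (dual_basis e 3) X Y
    + \<omega> (e 1) (e 4) * wedge_1_1 (dual_basis e 1) (dual_basis e 4) X Y
    + \<omega> (e 2) (e 3) * wedge_1_1 (dual_basis e 2) (dual_basis e 3) X Y
    + \<omega> (e 2) (e 4) * wedge_1_1 (dual_basis e 2) (dual_basis e 4) X Y
    + \<omega> (e 3) (e 4) * wedge_1_1 (dual_basis e 3) (dual_basis e 4) X Y)"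
proof (intro ext)
  fix X Y
  have b: "bilinear \<omega>" and a: "\<And>X. \<omega> X X = 0"
    using assms(2) by (auto simp: two_form_def)
  note bl = bilinear_ladd[OF b] bilinear_radd[OF b] bilinear_lmul[OF b] bilinear_rmul[OF b]
  note sk = two_form_skew[OF assms(2)]
  have s: "\<omega> (e 2) (e 1) = - \<omega> (e 1) (e 2)" "\<omega> (e 3) (e 1) = - \<omega> (e 1) (e 3)"
    "\<omega> (e 4) (e 1) = - \<omega> (e 1) (e 4)" "\<omega> (e 3) (e 2) = - \<omega> (e 2) (e 3)"
    "\<omega> (e 4) (e 2) = - \<omega> (e 2) (e 4)" "\<omega> (e 4) (e 3) = - \<omega> (e 3) (e 4)"
    by (rule sk)+
  define x where "x i = dual_basis e i X" for i
  define y where "y i = dual_basis e i Y" for i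
  have "\<omega> X Y = \<omega> (x 1 *\<^sub>R e 1 + x 2 *\<^sub>R e 2 + x 3 *\<^sub>R e 3 + x 4 *\<^sub>R e 4)
                 (y 1 *\<^sub>R e 1 + y 2 *\<^sub>R e 2 + y 3 *\<^sub>R e 3 + y 4 *\<^sub>R e 4)"
    unfolding x_def y_def
    using basis4_expansion[OF assms(1), of X] basis4_expansion[OF assms(1), of Y] by simp
  then show "\<omega> X Y =
      \<omega> (e 1) (e 2) * wedge_1_1 (dual_basis e 1) (dual_basis e 2) X Y
    + \<omega> (e 1) (e 3) * wedge_1_1 (dual_basis e 1) (dual_basis e 3) X Y
    + \<omega> (e 1) (e 4) * wedge_1_1 (dual_basis e 1) (dual_basis e 4) X Y
    + \<omega> (e 2) (e 3) * wedge_1_1 (dual_basis e 2) (dual_basis e 3) X Y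
    + \<omega> (e 2) (e 4) * wedge_1_1 (dual_basis e 2) (dual_basis e 4) X Y
    + \<omega> (e 3) (e 4) * wedge_1_1 (dual_basis e 3) (dual_basis e 4) X Y"
    by (simp add: wedge_1_1_def bl a s algebra_simps del: One_nat_def flip: x_def y_def)
qed

lemma two_form_wedge:
  assumes "linear \<theta>" "linear \<eta>" shows "two_form (wedge_1_1 \<theta> \<eta>)"
  unfolding two_form_def bilinear_def wedge_1_1_def
  by (auto intro!: linearI
      simp: linear_add[OF assms(1)] linear_add[OF assms(2)] linear_scale[OF assms(1)]
        linear_scale[OF assms(2)] algebra_simps)

lemma two_form_lincomb:
  assumes "two_form \<phi>" "two_form \<psi>" shows "two_form (\<lambda>X Y. a * \<phi> X Y + b * \<psi> X Y)"
proof -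
  have b: "bilinear \<phi>" "bilinear \<psi>" and al: "\<And>X. \<phi> X X = 0" "\<And>X. \<psi> X X = 0"
    using assms by (auto simp: two_form_def)
  show ?thesis
    unfolding two_form_def bilinear_def
    by (auto intro!: linearI
        simp: al bilinear_ladd[OF b(1)] bilinear_ladd[OF b(2)] bilinear_radd[OF b(1)]
          bilinear_radd[OF b(2)] bilinear_lmul[OF b(1)] bilinear_lmul[OF b(2)]
          bilinear_rmul[OF b(1)] bilinear_rmul[OF b(2)] algebra_simps)
qed

lemma is_ext_d2_formula:
  assumes "lie_bracket br"
  shows "is_ext_d2 br (\<lambda>\<omega> X Y Z. - \<omega> (br X Y) Z + \<omega> (br X Z) Y - \<omega> (br Y Z) X)"
  unfolding is_ext_d2_def wedge_1_1_def wedge_2_1_def wedge_1_2_def ext_d1_def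
  by (auto simp: fun_eq_iff algebra_simps)

lemma is_ext_d2_lincomb:
  assumes "is_ext_d2 br D" "two_form \<phi>" "two_form \<psi>"
  shows "D (\<lambda>X Y. a * \<phi> X Y + b * \<psi> X Y) = (\<lambda>X Y Z. a * D \<phi> X Y Z + b * D \<psi> X Y Z)"
  using assms unfolding is_ext_d2_def by blast

lemma is_ext_d2_wedge:
  assumes "is_ext_d2 br D" "linear \<theta>" "linear \<eta>"
  shows "D (wedge_1_1 \<theta> \<eta>) =
    (\<lambda>X Y Z. wedge_2_1 (ext_d1 br \<theta>) \<eta> X Y Z - wedge_1_2 \<theta> (ext_d1 br \<eta>) X Y Z)"
  using assms unfolding is_ext_d2_def by blast

lemma is_ext_d2_unique:
  fixes e :: "nat \<Rightarrow> 'a::real_vector" and br :: "'a \<Rightarrow> 'a \<Rightarrow> 'a"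
    and \<omega> :: "'a \<Rightarrow> 'a \<Rightarrow> real"
  assumes "basis4 e" "is_ext_d2 br D" "is_ext_d2 br D'" "two_form \<omega>"
  shows "D \<omega> = D' \<omega>"
proof -
  define E where "E i j = wedge_1_1 (dual_basis e i) (dual_basis e j)" for i j
  have tE: "two_form (E i j)" for i j
    unfolding E_def by (intro two_form_wedge linear_dual_basis assms)
  have DE: "D (E i j) = D' (E i j)" for i j
    unfolding E_def by (simp add: is_ext_d2_wedge[OF assms(2)] is_ext_d2_wedge[OF assms(3)]
        linear_dual_basis[OF assms(1)])
  have step: "two_form (\<lambda>X Y. \<phi> X Y + b * E i j X Y) \<and>
      D (\<lambda>X Y. \<phi> X Y + b * E i j X Y) = D' (\<lambda>X Y. \<phi> X Y + b * E i j X Y)"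
    if "two_form \<phi> \<and> D \<phi> = D' \<phi>" for \<phi> :: "'a \<Rightarrow> 'a \<Rightarrow> real" and b i j
    using is_ext_d2_lincomb[OF assms(2), of \<phi> "E i j" 1 b]
      is_ext_d2_lincomb[OF assms(3), of \<phi> "E i j" 1 b]
      two_form_lincomb[of \<phi> "E i j" 1 b] that tE[of i j] DE[of i j] by simp
  have start: "two_form (\<lambda>X Y. b * E i j X Y) \<and>
      D (\<lambda>X Y. b * E i j X Y) = D' (\<lambda>X Y. b * E i j X Y)" for b i j
    using is_ext_d2_lincomb[OF assms(2), of "E i j" "E i j" b 0]
      is_ext_d2_lincomb[OF assms(3), of "E i j" "E i j" b 0]
      two_form_lincomb[of "E i j" "E i j" b 0] tE[of i j] DE[of i j] by simp
  have "two_form \<omega> \<and> D \<omega> = D' \<omega>"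
    by (subst (1 2 3) two_form_basis_expansion[OF assms(1,4), folded E_def])
       (intro step start)
  then show ?thesis by blast
qed

lemma ext_d2_eq:
  fixes br :: "'a::real_vector \<Rightarrow> 'a \<Rightarrow> 'a" and e :: "nat \<Rightarrow> 'a"
  assumes "lie_bracket br" "basis4 e" "two_form \<omega>"
  shows "ext_d2 br \<omega> = (\<lambda>X Y Z. - \<omega> (br X Y) Z + \<omega> (br X Z) Y - \<omega> (br Y Z) X)"
proof -
  have "is_ext_d2 br (ext_d2 br)"
    unfolding ext_d2_def by (rule someI[of "is_ext_d2 br", OF is_ext_d2_formula[OF assms(1)]])
  from is_ext_d2_unique[OF assms(2) this is_ext_d2_formula[OF assms(1)] assms(3)]
  show ?thesis .
qed


section \<open>Four-dimensional solvable real Lie algebras\<close>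

text \<open>A trailing \<open>p\<close> stands for a prime.\<close>

datatype lie4 =
    A4 | RH3 | RR3 | RR3_par real | RR3p real | R2R2 | R2p | N4 | R4
  | R4_mu real | R4_ab real real | R4p real real | D4 | D4_par real | D4p real | H4

fun admissible :: "lie4 \<Rightarrow> bool" where
  "admissible (RR3_par l) \<longleftrightarrow> -1 \<le> l \<and> l \<le> 1"
| "admissible (RR3p c) \<longleftrightarrow> c \<ge> 0"
| "admissible (R4_ab a b) \<longleftrightarrow> a * b \<noteq> 0 \<and> -1 \<le> a \<and> a \<le> b \<and> b \<le> 1"
| "admissible (R4p c d) \<longleftrightarrow> d > 0"
| "admissible (D4_par l) \<longleftrightarrow> l \<ge> 1/2"
| "admissible (D4p d) \<longleftrightarrow> d \<ge> 0"
| "admissible _ \<longleftrightarrow> True"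

fun bracket_table :: "lie4 \<Rightarrow> (nat \<Rightarrow> 'a::real_vector) \<Rightarrow> ((nat \<times> nat) \<times> 'a) list" where
  "bracket_table A4 e = []"
| "bracket_table RH3 e = [((1,2), e 3)]"
| "bracket_table RR3 e = [((1,2), e 2), ((1,3), e 2 + e 3)]"
| "bracket_table (RR3_par l) e = [((1,2), e 2), ((1,3), l *\<^sub>R e 3)]"
| "bracket_table (RR3p c) e = [((1,2), c *\<^sub>R e 2 - e 3), ((1,3), e 2 + c *\<^sub>R e 3)]"
| "bracket_table R2R2 e = [((1,2), e 2), ((3,4), e 4)]"
| "bracket_table R2p e = [((1,3), e 3), ((1,4), e 4), ((2,3), e 4), ((2,4), - e 3)]"
| "bracket_table N4 e = [((4,1), e 2), ((4,2), e 3)]"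
| "bracket_table R4 e = [((4,1), e 1), ((4,2), e 1 + e 2), ((4,3), e 2 + e 3)]"
| "bracket_table (R4_mu m) e =
     [((4,1), e 1), ((4,2), m *\<^sub>R e 2), ((4,3), e 2 + m *\<^sub>R e 3)]"
| "bracket_table (R4_ab a b) e = [((4,1), e 1), ((4,2), a *\<^sub>R e 2), ((4,3), b *\<^sub>R e 3)]"
| "bracket_table (R4p c d) e =
     [((4,1), e 1), ((4,2), c *\<^sub>R e 2 - d *\<^sub>R e 3), ((4,3), d *\<^sub>R e 2 + c *\<^sub>R e 3)]"
| "bracket_table D4 e = [((1,2), e 3), ((4,1), e 1), ((4,2), - e 2)]"
| "bracket_table (D4_par l) e =
     [((1,2), e 3), ((4,3), e 3), ((4,1), l *\<^sub>R e 1), ((4,2), (1 - l) *\<^sub>R e 2)]"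
| "bracket_table (D4p d) e =
     [((1,2), e 3), ((4,1), (d/2) *\<^sub>R e 1 - e 2), ((4,3), d *\<^sub>R e 3),
      ((4,2), e 1 + (d/2) *\<^sub>R e 2)]"
| "bracket_table H4 e =
     [((1,2), e 3), ((4,3), e 3), ((4,1), (1/2) *\<^sub>R e 1), ((4,2), e 1 + (1/2) *\<^sub>R e 2)]"

definition has_brackets ::
  "('a::real_vector \<Rightarrow> 'a \<Rightarrow> 'a) \<Rightarrow> (nat \<Rightarrow> 'a) \<Rightarrow> lie4 \<Rightarrow> bool" where
  "has_brackets br e g \<longleftrightarrow>
     (\<forall>((i, j), v) \<in> set (bracket_table g e). br (e i) (e j) = v) \<and>
     (\<forall>i\<in>{1..4}. \<forall>j\<in>{1..4}.
        (i, j) \<notin> fst ` set (bracket_table g e) \<longrightarrow> (j, i) \<notin> fst ` set (bracket_table g e) \<longrightarrow>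
        br (e i) (e j) = 0)"

end

theory Submission
  imports Defs
begin

text \<open>Evaluating a closed 2-form on the four increasing triples of basis vectors turns closedness
  into a linear system in the six coefficients \<open>\<omega>(e\<^sub>i, e\<^sub>j)\<close>, and non-degeneracy says that the
  Pfaffian of these coefficients does not vanish.  For each algebra the linear system is solved
  and substituted into the Pfaffian.\<close>

text \<open>With \<open>1\<close> rewritten to \<open>Suc 0\<close>, \<open>e 1\<close> would stop
  matching facts stated with the numeral.\<close>

declare One_nat_def [simp del]

section \<open>2-forms and their values on a basis\<close>

lemma two_form_bilinear: "two_form \<omega> \<Longrightarrow> bilinear \<omega>"
  by (simp add: two_form_def)

lemma two_form_self: "two_form \<omega> \<Longrightarrow> \<omega> X X = 0"
  by (simp add: two_form_def)

lemma two_form_add: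
  assumes "two_form \<phi>" "two_form \<psi>" shows "two_form (\<lambda>X Y. \<phi> X Y + \<psi> X Y)"
  using two_form_lincomb[OF assms, of 1 1] by simp

lemma two_form_scale:
  assumes "two_form \<phi>" shows "two_form (\<lambda>X Y. c * \<phi> X Y)"
  using two_form_lincomb[OF assms assms, of c 0] by simp

lemma two_form_minus:
  assumes "two_form \<phi>" shows "two_form (\<lambda>X Y. - \<phi> X Y)"
  using two_form_scale[OF assms, of "-1"] by simp

lemma two_form_diff:
  assumes "two_form \<phi>" "two_form \<psi>" shows "two_form (\<lambda>X Y. \<phi> X Y - \<psi> X Y)"
  using two_form_lincomb[OF assms, of 1 "-1"] by simp

text \<open>Applied to one argument after another, this reduces a multilinear identity to basis
  vectors.\<close>

lemma basis4_linear_eq_0: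
  assumes "basis4 e" "linear f" "\<And>i. i \<in> {1..4} \<Longrightarrow> f (e i) = 0"
  shows "f x = 0"
proof (rule linear_eq_0_on_span[OF assms(2)])
  show "x \<in> span (e ` {1..4})"
    using assms(1) by (simp add: basis4_def)
qed (use assms(3) in blast)

lemma dual_basis_basis:
  assumes "basis4 e" "i \<in> {1..4}" "j \<in> {1..4}"
  shows "dual_basis e i (e j) = (if i = j then 1 else 0)"
proof -
  have inj: "inj_on e {1..4}" and ind: "independent (e ` {1..4})"
    using assms(1) by (auto simp: basis4_def)
  have "dual_basis e i (e j) = (if e i = e j then 1 else 0)"
    unfolding dual_basis_def by (subst representation_basis[OF ind]) (use assms(3) in auto)
  then show ?thesis
    using inj_on_eq_iff[OF inj assms(2,3)] by simp
qed

lemma ball_1_4: "(\<forall>i\<in>{1..4::nat}. P i) \<longleftrightarrow> P 1 \<and> P 2 \<and> P 3 \<and> P 4"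
proof -
  have "{1..4::nat} = {1, 2, 3, 4}" by auto
  then show ?thesis by simp
qed

text \<open>Bilinearity and skew-symmetry leave six independent values.
  \<open>two_form \<omega>\<close> sits on the right, so that the equivalence rewrites an equation
  with an explicit normal form \<open>\<psi>\<close> without prior knowledge of
  \<open>\<omega>\<close>.\<close>

lemma two_form_eq_iff:
  assumes e: "basis4 e" and \<psi>: "two_form \<psi>"
  shows "\<omega> = \<psi> \<longleftrightarrow> two_form \<omega> \<and>
    \<omega> (e 1) (e 2) = \<psi> (e 1) (e 2) \<and> \<omega> (e 1) (e 3) = \<psi> (e 1) (e 3) \<and>
    \<omega> (e 1) (e 4) = \<psi> (e 1) (e 4) \<and> \<omega> (e 2) (e 3) = \<psi> (e 2) (e 3) \<and>
    \<omega> (e 2) (e 4) = \<psi> (e 2) (e 4) \<and> \<omega> (e 3) (e 4) = \<psi> (e 3) (e 4)"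
    (is "?l \<longleftrightarrow> ?r")
proof
  assume r: ?r
  then have "two_form \<omega>" by blast
  show ?l
    by (rule trans[OF two_form_basis_expansion[OF e \<open>two_form \<omega>\<close>]
          trans[OF _ two_form_basis_expansion[OF e \<psi>, symmetric]]])
       (simp add: r)
qed (use \<psi> in simp)

section \<open>Non-degeneracy and the Pfaffian\<close>

definition pfaffian :: "(nat \<Rightarrow> 'a) \<Rightarrow> ('a \<Rightarrow> 'a \<Rightarrow> real) \<Rightarrow> real" where
  "pfaffian e \<omega> = \<omega> (e 1) (e 2) * \<omega> (e 3) (e 4) - \<omega> (e 1) (e 3) * \<omega> (e 2) (e 4)
     + \<omega> (e 1) (e 4) * \<omega> (e 2) (e 3)"

text \<open>An alternating 4-form on a four-dimensional space is determined by its value on the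
  basis. For \<open>\<omega> \<and> \<omega>\<close> this value is twice the Pfaffian, since the six
  shuffles pair off into three equal products.\<close>

lemma wedge_2_2_eq_0_iff:
  assumes e: "basis4 e" and w: "two_form \<omega>"
  shows "wedge_2_2 \<omega> \<omega> = (\<lambda>X Y Z W. 0) \<longleftrightarrow> pfaffian e \<omega> = 0"
proof
  assume "wedge_2_2 \<omega> \<omega> = (\<lambda>X Y Z W. 0)"
  then have "wedge_2_2 \<omega> \<omega> (e 1) (e 2) (e 3) (e 4) = 0" by simp
  then show "pfaffian e \<omega> = 0"
    by (simp add: wedge_2_2_def pfaffian_def algebra_simps)
next
  assume pf: "pfaffian e \<omega> = 0"
  note b = two_form_bilinear[OF w]
  note bl = bilinear_ladd[OF b] bilinear_radd[OF b] bilinear_lmul[OF b] bilinear_rmul[OF b]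
  have lin: "linear (\<lambda>X. wedge_2_2 \<omega> \<omega> X Y Z W)" "linear (\<lambda>X. wedge_2_2 \<omega> \<omega> Y X Z W)"
    "linear (\<lambda>X. wedge_2_2 \<omega> \<omega> Y Z X W)" "linear (\<lambda>X. wedge_2_2 \<omega> \<omega> Y Z W X)" for Y Z W
    by (auto intro!: linearI simp: wedge_2_2_def bl algebra_simps)
  let ?W = "wedge_2_2 \<omega> \<omega>"
  have swap: "?W Y X Z V = - ?W X Y Z V" "?W Z Y X V = - ?W Z X Y V" "?W Z V Y X = - ?W Z V X Y"
    for X Y Z V
    using two_form_skew[OF w, of X Y]
    by (simp_all add: wedge_2_2_def algebra_simps two_form_skew[OF w, of X Y])
  have rep: "?W X X Y Z = 0" "?W Y X X Z = 0" "?W Y Z X X = 0" for X Y Z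
    by (simp_all add: wedge_2_2_def two_form_self[OF w])
  \<comment> \<open>Instantiated at increasing indices only, the adjacent swaps rewrite just the
    out-of-order neighbours, so the simplifier performs a terminating bubble sort;
    \<open>rep\<close> disposes of repeated vectors.\<close>
  note sort = swap[where X="e 1" and Y="e 2"] swap[where X="e 1" and Y="e 3"]
    swap[where X="e 1" and Y="e 4"] swap[where X="e 2" and Y="e 3"]
    swap[where X="e 2" and Y="e 4"] swap[where X="e 3" and Y="e 4"]
  have "?W (e 1) (e 2) (e 3) (e 4) = 2 * pfaffian e \<omega>"
    by (simp add: wedge_2_2_def pfaffian_def algebra_simps)
  then have "\<forall>i\<in>{1..4}. \<forall>j\<in>{1..4}. \<forall>k\<in>{1..4}. \<forall>l\<in>{1..4}. ?W (e i) (e j) (e k) (e l) = 0"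
    unfolding ball_1_4 by (simp add: pf rep sort)
  then have "?W X Y Z V = 0" for X Y Z V
    by - (rule basis4_linear_eq_0[OF e lin(1)], rule basis4_linear_eq_0[OF e lin(2)],
        rule basis4_linear_eq_0[OF e lin(3)], rule basis4_linear_eq_0[OF e lin(4)], blast)
  then show "wedge_2_2 \<omega> \<omega> = (\<lambda>X Y Z W. 0)" by blast
qed

section \<open>Closedness on basis triples\<close>

lemma lie_bracket_skew:
  assumes "lie_bracket br" shows "br y x = - br x y"
proof -
  have b: "bilinear br" and a: "\<And>x. br x x = 0"
    using assms by (auto simp: lie_bracket_def)
  have "br (x + y) (x + y) = br x x + br x y + (br y x + br y y)"
    by (simp add: bilinear_ladd[OF b] bilinear_radd[OF b])
  then show ?thesis by (simp add: a add_eq_0_iff2)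
qed

text \<open>The Chevalley-Eilenberg formula for the differential of \<open>\<omega>\<close>, as
  supplied by \<open>ext_d2_eq\<close>. As a constant of its own it lets the values on basis triples
  serve as rewrite rules.\<close>

definition cocycle_defect ::
  "('a::real_vector \<Rightarrow> 'a \<Rightarrow> 'a) \<Rightarrow> ('a \<Rightarrow> 'a \<Rightarrow> real) \<Rightarrow> 'a \<Rightarrow> 'a \<Rightarrow> 'a \<Rightarrow> real" where
  "cocycle_defect br \<omega> X Y Z = - \<omega> (br X Y) Z + \<omega> (br X Z) Y - \<omega> (br Y Z) X"

text \<open>The defect is trilinear and alternating, hence fixed by the four increasing triples, one
  for each dimension of the space of 3-forms.\<close>

lemma cocycle_defect_eq_0_iff:
  assumes br: "lie_bracket br" and e: "basis4 e" and w: "two_form \<omega>"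
  shows "(\<forall>X Y Z. cocycle_defect br \<omega> X Y Z = 0) \<longleftrightarrow>
    cocycle_defect br \<omega> (e 1) (e 2) (e 3) = 0 \<and> cocycle_defect br \<omega> (e 1) (e 2) (e 4) = 0 \<and>
    cocycle_defect br \<omega> (e 1) (e 3) (e 4) = 0 \<and> cocycle_defect br \<omega> (e 2) (e 3) (e 4) = 0"
    (is "_ \<longleftrightarrow> ?r")
proof (intro iffI allI)
  fix X Y Z
  let ?D = "cocycle_defect br \<omega>"
  assume r: ?r
  have b': "bilinear br" and br0: "br x x = 0" for x using br by (auto simp: lie_bracket_def)
  note b = two_form_bilinear[OF w]
  note bl = bilinear_ladd[OF b] bilinear_radd[OF b] bilinear_lmul[OF b] bilinear_rmul[OF b]
    bilinear_ladd[OF b'] bilinear_radd[OF b'] bilinear_lmul[OF b'] bilinear_rmul[OF b']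
  have lin: "linear (\<lambda>X. ?D X Y Z)" "linear (\<lambda>X. ?D Y X Z)" "linear (\<lambda>X. ?D Y Z X)" for Y Z
    by (auto intro!: linearI simp: cocycle_defect_def bl algebra_simps)
  have swap: "?D Y X Z = - ?D X Y Z" "?D Z Y X = - ?D Z X Y" for X Y Z
    by (simp_all add: cocycle_defect_def bilinear_lneg[OF b] lie_bracket_skew[OF br, of Y X])
  have rep: "?D X X Y = 0" "?D X Y Y = 0" "?D X Y X = 0" for X Y
    using br0
    by (simp_all add: cocycle_defect_def bilinear_lzero[OF b] bilinear_lneg[OF b]
        lie_bracket_skew[OF br, of X Y])
  note sort = swap[where X="e 1" and Y="e 2"] swap[where X="e 1" and Y="e 3"]
    swap[where X="e 1" and Y="e 4"] swap[where X="e 2" and Y="e 3"]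
    swap[where X="e 2" and Y="e 4"] swap[where X="e 3" and Y="e 4"]
  have "\<forall>i\<in>{1..4}. \<forall>j\<in>{1..4}. \<forall>k\<in>{1..4}. ?D (e i) (e j) (e k) = 0"
    using r unfolding ball_1_4 by (simp add: rep sort)
  then show "?D X Y Z = 0"
    by - (rule basis4_linear_eq_0[OF e lin(1)], rule basis4_linear_eq_0[OF e lin(2)],
        rule basis4_linear_eq_0[OF e lin(3)], blast)
qed simp

lemma symplectic_form_iff:
  assumes br: "lie_bracket br" and e: "basis4 e"
  shows "symplectic_form br \<omega> \<longleftrightarrow> two_form \<omega> \<and>
    cocycle_defect br \<omega> (e 1) (e 2) (e 3) = 0 \<and> cocycle_defect br \<omega> (e 1) (e 2) (e 4) = 0 \<and>
    cocycle_defect br \<omega> (e 1) (e 3) (e 4) = 0 \<and> cocycle_defect br \<omega> (e 2) (e 3) (e 4) = 0 \<and>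
    pfaffian e \<omega> \<noteq> 0"
\<comment> \<open>\<open>ext_d2\<close> has a known value on 2-forms only; elsewhere both sides are
  false.\<close>
proof (cases "two_form \<omega>")
  case True
  have "ext_d2 br \<omega> = (\<lambda>X Y Z. 0) \<longleftrightarrow> (\<forall>X Y Z. cocycle_defect br \<omega> X Y Z = 0)"
    by (simp add: ext_d2_eq[OF br e True] cocycle_defect_def fun_eq_iff)
  then show ?thesis
    using True wedge_2_2_eq_0_iff[OF e True] cocycle_defect_eq_0_iff[OF br e True]
    by (auto simp: symplectic_form_def)
qed (simp add: symplectic_form_def)

text \<open>With \<open>z = x + i y\<close> the system reads \<open>(c + i d) z = 0\<close>, and
  \<open>d \<noteq> 0\<close> makes the factor invertible. It arises for \<open>RR3p\<close>,
  \<open>R4p\<close> and \<open>D4p\<close>, where a basis vector acts by rotating a plane.\<close>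

lemma rotation_system_iff:
  fixes c d x y :: real
  assumes "d \<noteq> 0"
  shows "c * x = d * y \<and> c * y = - d * x \<longleftrightarrow> x = 0 \<and> y = 0"
proof (intro iffI; elim conjE)
  assume eqs: "c * x = d * y" "c * y = - d * x"
  have "d * (x\<^sup>2 + y\<^sup>2) = y * (d * y) - x * (- d * x)"
    by (simp add: power2_eq_square algebra_simps)
  also have "\<dots> = 0"
    unfolding eqs[symmetric] by simp
  finally show "x = 0 \<and> y = 0"
    using assms by (simp add: sum_power2_eq_zero_iff)
qed simp

section \<open>Coefficients of a 2-form in a fixed frame\<close>

locale lie_frame =
  fixes br :: "'a::real_vector \<Rightarrow> 'a \<Rightarrow> 'a" and e :: "nat \<Rightarrow> 'a"
  assumes br: "lie_bracket br" and basis: "basis4 e"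
begin

abbreviation E :: "nat \<Rightarrow> nat \<Rightarrow> 'a \<Rightarrow> 'a \<Rightarrow> real" where
  "E i j \<equiv> wedge_1_1 (dual_basis e i) (dual_basis e j)"

lemma E_basis:
  assumes "i \<in> {1..4}" "j \<in> {1..4}" "k \<in> {1..4}" "l \<in> {1..4}"
  shows "E i j (e k) (e l) =
    (if i = k \<and> j = l then 1 else 0) - (if i = l \<and> j = k then 1 else 0)"
proof -
  have "(if p then 1 else 0) * (if q then 1 else 0) = (if p \<and> q then 1 else (0::real))" for p q
    by simp
  then show ?thesis
    by (simp only: wedge_1_1_def dual_basis_basis[OF basis] assms)
qed

lemma two_form_E: "two_form (E i j)"
  by (intro two_form_wedge linear_dual_basis basis)

lemmas two_form_intros = two_form_add two_form_diff two_form_minus two_form_scale two_form_E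

text \<open>The six coefficients can be prescribed freely, so the existence of a suitable 2-form is
  a question about six reals.\<close>

lemma ex_two_form_iff:
  "(\<exists>\<omega>. two_form \<omega> \<and> P (\<omega> (e 1) (e 2)) (\<omega> (e 1) (e 3)) (\<omega> (e 1) (e 4))
      (\<omega> (e 2) (e 3)) (\<omega> (e 2) (e 4)) (\<omega> (e 3) (e 4))) \<longleftrightarrow>
   (\<exists>a12 a13 a14 a23 a24 a34. P a12 a13 a14 a23 a24 a34)"
proof (intro iffI; elim exE conjE)
  fix a12 a13 a14 a23 a24 a34
  assume "P a12 a13 a14 a23 a24 a34"
  moreover define \<omega> where "\<omega> = (\<lambda>X Y. a12 * E 1 2 X Y + a13 * E 1 3 X Y + a14 * E 1 4 X Y
          + a23 * E 2 3 X Y + a24 * E 2 4 X Y + a34 * E 3 4 X Y)"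
  have "two_form \<omega>"
    unfolding \<omega>_def by (intro two_form_intros)
  moreover have "\<omega> (e 1) (e 2) = a12" "\<omega> (e 1) (e 3) = a13" "\<omega> (e 1) (e 4) = a14"
    "\<omega> (e 2) (e 3) = a23" "\<omega> (e 2) (e 4) = a24" "\<omega> (e 3) (e 4) = a34"
    by (simp_all add: \<omega>_def E_basis)
  ultimately show "\<exists>\<omega>. two_form \<omega> \<and> P (\<omega> (e 1) (e 2)) (\<omega> (e 1) (e 3)) (\<omega> (e 1) (e 4))
      (\<omega> (e 2) (e 3)) (\<omega> (e 2) (e 4)) (\<omega> (e 3) (e 4))"
    by blast
qed blast

end

text \<open>The solved form of the system \<open>d\<omega> = 0\<close>.  It is equivalent to that system for admissible
  parameters only: \<open>d \<noteq> 0\<close> is needed for \<open>R4p c d\<close> and \<open>l \<noteq> -1\<close> for \<open>D4_par l\<close>.\<close>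

fun closed_coeffs :: "lie4 \<Rightarrow> real \<Rightarrow> real \<Rightarrow> real \<Rightarrow> real \<Rightarrow> real \<Rightarrow> real \<Rightarrow> bool" where
  "closed_coeffs A4 a12 a13 a14 a23 a24 a34 \<longleftrightarrow> True"
| "closed_coeffs RH3 a12 a13 a14 a23 a24 a34 \<longleftrightarrow> a34 = 0"
| "closed_coeffs RR3 a12 a13 a14 a23 a24 a34 \<longleftrightarrow> a23 = 0 \<and> a24 = 0 \<and> a34 = 0"
| "closed_coeffs (RR3_par l) a12 a13 a14 a23 a24 a34 \<longleftrightarrow>
     (1 + l) * a23 = 0 \<and> a24 = 0 \<and> l * a34 = 0"
| "closed_coeffs (RR3p c) a12 a13 a14 a23 a24 a34 \<longleftrightarrow> c * a23 = 0 \<and> a24 = 0 \<and> a34 = 0"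
| "closed_coeffs R2R2 a12 a13 a14 a23 a24 a34 \<longleftrightarrow> a14 = 0 \<and> a23 = 0 \<and> a24 = 0"
| "closed_coeffs R2p a12 a13 a14 a23 a24 a34 \<longleftrightarrow> a23 = a14 \<and> a24 = - a13 \<and> a34 = 0"
| "closed_coeffs N4 a12 a13 a14 a23 a24 a34 \<longleftrightarrow> a13 = 0 \<and> a23 = 0"
| "closed_coeffs R4 a12 a13 a14 a23 a24 a34 \<longleftrightarrow> a12 = 0 \<and> a13 = 0 \<and> a23 = 0"
| "closed_coeffs (R4_mu m) a12 a13 a14 a23 a24 a34 \<longleftrightarrow>
     a12 = 0 \<and> (1 + m) * a13 = 0 \<and> m * a23 = 0"
| "closed_coeffs (R4_ab a b) a12 a13 a14 a23 a24 a34 \<longleftrightarrow>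
     (1 + a) * a12 = 0 \<and> (1 + b) * a13 = 0 \<and> (a + b) * a23 = 0"
| "closed_coeffs (R4p c d) a12 a13 a14 a23 a24 a34 \<longleftrightarrow> a12 = 0 \<and> a13 = 0 \<and> c * a23 = 0"
| "closed_coeffs D4 a12 a13 a14 a23 a24 a34 \<longleftrightarrow> a13 = 0 \<and> a23 = 0 \<and> a34 = 0"
| "closed_coeffs (D4_par l) a12 a13 a14 a23 a24 a34 \<longleftrightarrow>
     a34 = - a12 \<and> a13 = 0 \<and> (2 - l) * a23 = 0"
| "closed_coeffs (D4p d) a12 a13 a14 a23 a24 a34 \<longleftrightarrow> a13 = 0 \<and> a23 = 0 \<and> a34 = - d * a12"
| "closed_coeffs H4 a12 a13 a14 a23 a24 a34 \<longleftrightarrow> a13 = 0 \<and> a23 = 0 \<and> a34 = - a12"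

section \<open>Solving the closedness equations algebra by algebra\<close>

context lie_frame
begin

text \<open>For each algebra the bracket table turns the four defects into linear expressions in the
  coefficients (the facts \<open>D\<close>); the resulting homogeneous system is then
  solved.\<close>

lemma cocycle_defect_basis_iff:
  assumes hb: "has_brackets br e g" and adm: "admissible g" and w: "two_form \<omega>"
  shows "cocycle_defect br \<omega> (e 1) (e 2) (e 3) = 0 \<and> cocycle_defect br \<omega> (e 1) (e 2) (e 4) = 0 \<and>
      cocycle_defect br \<omega> (e 1) (e 3) (e 4) = 0 \<and> cocycle_defect br \<omega> (e 2) (e 3) (e 4) = 0 \<longleftrightarrow>
    closed_coeffs g (\<omega> (e 1) (e 2)) (\<omega> (e 1) (e 3)) (\<omega> (e 1) (e 4))
      (\<omega> (e 2) (e 3)) (\<omega> (e 2) (e 4)) (\<omega> (e 3) (e 4))"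
    (is "?closed \<longleftrightarrow> _")
proof -
  define a12 a13 a14 a23 a24 a34 where a:
    "a12 = \<omega> (e 1) (e 2)" "a13 = \<omega> (e 1) (e 3)" "a14 = \<omega> (e 1) (e 4)"
    "a23 = \<omega> (e 2) (e 3)" "a24 = \<omega> (e 2) (e 4)" "a34 = \<omega> (e 3) (e 4)"
  note b = two_form_bilinear[OF w]
  note bl = bilinear_ladd[OF b] bilinear_lmul[OF b] bilinear_lneg[OF b] bilinear_lsub[OF b]
    bilinear_lzero[OF b] two_form_self[OF w]
  have sk: "\<omega> (e 2) (e 1) = - a12" "\<omega> (e 3) (e 1) = - a13" "\<omega> (e 4) (e 1) = - a14"
    "\<omega> (e 3) (e 2) = - a23" "\<omega> (e 4) (e 2) = - a24" "\<omega> (e 4) (e 3) = - a34"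
    unfolding a by (rule two_form_skew[OF w])+
  \<comment> \<open>Tables of algebras on which \<open>e 4\<close> acts list
    \<open>[e 4, e i]\<close>, while increasing triples produce
    \<open>br (e i) (e 4)\<close>.\<close>
  have flip: "br (e 1) (e 4) = - br (e 4) (e 1)" "br (e 2) (e 4) = - br (e 4) (e 2)"
    "br (e 3) (e 4) = - br (e 4) (e 3)"
    by (rule lie_bracket_skew[OF br])+
  let ?D = "cocycle_defect br \<omega>"
  note brackets = hb[unfolded has_brackets_def ball_1_4]
  note eval = cocycle_defect_def bl sk a[symmetric]
  show ?thesis
    unfolding a[symmetric]
  proof (cases g)
    case A4
    have D: "?D (e 1) (e 2) (e 3) = 0" "?D (e 1) (e 2) (e 4) = 0"
      "?D (e 1) (e 3) (e 4) = 0" "?D (e 2) (e 3) (e 4) = 0"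
      by (simp_all add: brackets[unfolded A4, simplified] eval)
    show "?closed \<longleftrightarrow> closed_coeffs g a12 a13 a14 a23 a24 a34"
      by (simp add: A4 D)
  next
    case RH3
    have D: "?D (e 1) (e 2) (e 3) = 0" "?D (e 1) (e 2) (e 4) = - a34"
      "?D (e 1) (e 3) (e 4) = 0" "?D (e 2) (e 3) (e 4) = 0"
      by (simp_all add: brackets[unfolded RH3, simplified] eval)
    show "?closed \<longleftrightarrow> closed_coeffs g a12 a13 a14 a23 a24 a34"
      by (simp add: RH3 D)
  next
    case RR3
    have D: "?D (e 1) (e 2) (e 3) = - 2 * a23" "?D (e 1) (e 2) (e 4) = - a24"
      "?D (e 1) (e 3) (e 4) = - a24 - a34" "?D (e 2) (e 3) (e 4) = 0"
      by (simp_all add: brackets[unfolded RR3, simplified] eval)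
    show "?closed \<longleftrightarrow> closed_coeffs g a12 a13 a14 a23 a24 a34"
      by (auto simp: RR3 D)
  next
    case (RR3_par l)
    have D: "?D (e 1) (e 2) (e 3) = - ((1 + l) * a23)" "?D (e 1) (e 2) (e 4) = - a24"
      "?D (e 1) (e 3) (e 4) = - (l * a34)" "?D (e 2) (e 3) (e 4) = 0"
      by (simp_all add: brackets[unfolded RR3_par, simplified] eval algebra_simps)
    show "?closed \<longleftrightarrow> closed_coeffs g a12 a13 a14 a23 a24 a34"
      by (auto simp: RR3_par D)
  next
    case (RR3p c)
    have D: "?D (e 1) (e 2) (e 3) = - 2 * (c * a23)" "?D (e 1) (e 2) (e 4) = a34 - c * a24"
      "?D (e 1) (e 3) (e 4) = - a24 - c * a34" "?D (e 2) (e 3) (e 4) = 0"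
      by (simp_all add: brackets[unfolded RR3p, simplified] eval algebra_simps)
    \<comment> \<open>A rotation system in \<open>a24\<close> and \<open>a34\<close> with
      \<open>d = 1\<close>; the factors \<open>1\<close> and \<open>- 1\<close> are written out to
      match \<open>rotation_system_iff\<close> literally.\<close>
    have "?closed \<longleftrightarrow> c * a23 = 0 \<and> c * a24 = 1 * a34 \<and> c * a34 = - 1 * a24"
      unfolding D by (intro iffI conjI; elim conjE; linarith)
    then show "?closed \<longleftrightarrow> closed_coeffs g a12 a13 a14 a23 a24 a34"
      unfolding rotation_system_iff[OF one_neq_zero] by (simp add: RR3p)
  next
    case R2R2
    have D: "?D (e 1) (e 2) (e 3) = - a23" "?D (e 1) (e 2) (e 4) = - a24"
      "?D (e 1) (e 3) (e 4) = a14" "?D (e 2) (e 3) (e 4) = a24"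
      by (simp_all add: brackets[unfolded R2R2, simplified] eval)
    show "?closed \<longleftrightarrow> closed_coeffs g a12 a13 a14 a23 a24 a34"
      by (auto simp: R2R2 D)
  next
    case R2p
    have D: "?D (e 1) (e 2) (e 3) = a14 - a23" "?D (e 1) (e 2) (e 4) = - a24 - a13"
      "?D (e 1) (e 3) (e 4) = - 2 * a34" "?D (e 2) (e 3) (e 4) = 0"
      by (simp_all add: brackets[unfolded R2p, simplified] eval)
    show "?closed \<longleftrightarrow> closed_coeffs g a12 a13 a14 a23 a24 a34"
      by (auto simp: R2p D)
  next
    case N4
    have D: "?D (e 1) (e 2) (e 3) = 0" "?D (e 1) (e 2) (e 4) = - a13"
      "?D (e 1) (e 3) (e 4) = - a23" "?D (e 2) (e 3) (e 4) = 0"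
      by (simp_all add: brackets[unfolded N4, simplified] flip eval)
    show "?closed \<longleftrightarrow> closed_coeffs g a12 a13 a14 a23 a24 a34"
      by (simp add: N4 D)
  next
    case R4
    have D: "?D (e 1) (e 2) (e 3) = 0" "?D (e 1) (e 2) (e 4) = - 2 * a12"
      "?D (e 1) (e 3) (e 4) = - a12 - 2 * a13" "?D (e 2) (e 3) (e 4) = - a13 - 2 * a23"
      by (simp_all add: brackets[unfolded R4, simplified] flip eval)
    show "?closed \<longleftrightarrow> closed_coeffs g a12 a13 a14 a23 a24 a34"
      by (auto simp: R4 D)
  next
    case (R4_mu m)
    have D: "?D (e 1) (e 2) (e 3) = 0" "?D (e 1) (e 2) (e 4) = - ((1 + m) * a12)"
      "?D (e 1) (e 3) (e 4) = - a12 - (1 + m) * a13" "?D (e 2) (e 3) (e 4) = - (2 * m * a23)"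
      by (simp_all add: brackets[unfolded R4_mu, simplified] flip eval algebra_simps)
    \<comment> \<open>\<open>a12 = 0\<close> holds for every \<open>m\<close>: by the second defect
      if \<open>1 + m \<noteq> 0\<close>, by the third if \<open>m = -1\<close>.\<close>
    show "?closed \<longleftrightarrow> closed_coeffs g a12 a13 a14 a23 a24 a34"
      by (auto simp: R4_mu D)
  next
    case (R4_ab u v)
    have D: "?D (e 1) (e 2) (e 3) = 0" "?D (e 1) (e 2) (e 4) = - ((1 + u) * a12)"
      "?D (e 1) (e 3) (e 4) = - ((1 + v) * a13)" "?D (e 2) (e 3) (e 4) = - ((u + v) * a23)"
      by (simp_all add: brackets[unfolded R4_ab, simplified] flip eval algebra_simps)
    show "?closed \<longleftrightarrow> closed_coeffs g a12 a13 a14 a23 a24 a34"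
      by (auto simp: R4_ab D)
  next
    case (R4p c d)
    have "d \<noteq> 0"
      using adm R4p by simp
    have D: "?D (e 1) (e 2) (e 3) = 0" "?D (e 1) (e 2) (e 4) = d * a13 - (1 + c) * a12"
      "?D (e 1) (e 3) (e 4) = - d * a12 - (1 + c) * a13" "?D (e 2) (e 3) (e 4) = - 2 * (c * a23)"
      by (simp_all add: brackets[unfolded R4p, simplified] flip eval algebra_simps)
    \<comment> \<open>The grouping isolates a rotation system in \<open>a12\<close> and
      \<open>a13\<close>, with \<open>1 + c\<close> in the role of \<open>c\<close>.\<close>
    have "?closed \<longleftrightarrow> ((1 + c) * a12 = d * a13 \<and> (1 + c) * a13 = - d * a12) \<and> c * a23 = 0"
      unfolding D by (intro iffI conjI; elim conjE; linarith)
    then show "?closed \<longleftrightarrow> closed_coeffs g a12 a13 a14 a23 a24 a34"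
      unfolding rotation_system_iff[OF \<open>d \<noteq> 0\<close>] by (simp add: R4p)
  next
    case D4
    have D: "?D (e 1) (e 2) (e 3) = 0" "?D (e 1) (e 2) (e 4) = - a34"
      "?D (e 1) (e 3) (e 4) = - a13" "?D (e 2) (e 3) (e 4) = a23"
      by (simp_all add: brackets[unfolded D4, simplified] flip eval)
    show "?closed \<longleftrightarrow> closed_coeffs g a12 a13 a14 a23 a24 a34"
      by (auto simp: D4 D)
  next
    case (D4_par l)
    \<comment> \<open>This forces \<open>a13 = 0\<close>. The factor \<open>2 - l\<close> of
      \<open>a23\<close> may vanish, which makes \<open>D4_par 2\<close> special.\<close>
    have "1 + l \<noteq> 0"
      using adm D4_par by simp
    have D: "?D (e 1) (e 2) (e 3) = 0" "?D (e 1) (e 2) (e 4) = - a34 - a12"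
      "?D (e 1) (e 3) (e 4) = - ((1 + l) * a13)" "?D (e 2) (e 3) (e 4) = - ((2 - l) * a23)"
      by (simp_all add: brackets[unfolded D4_par, simplified] flip eval algebra_simps)
    show "?closed \<longleftrightarrow> closed_coeffs g a12 a13 a14 a23 a24 a34"
      using \<open>1 + l \<noteq> 0\<close> by (auto simp: D4_par D)
  next
    case (D4p d)
    have D: "?D (e 1) (e 2) (e 3) = 0" "?D (e 1) (e 2) (e 4) = - a34 - d * a12"
      "?D (e 1) (e 3) (e 4) = a23 - 3 * d / 2 * a13" "?D (e 2) (e 3) (e 4) = - a13 - 3 * d / 2 * a23"
      by (simp_all add: brackets[unfolded D4p, simplified] flip eval algebra_simps)
    \<comment> \<open>The last two equations form a rotation system with \<open>3 * d / 2\<close> in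
      the role of \<open>c\<close>, so \<open>a13\<close> and \<open>a23\<close> vanish even for
      \<open>d = 0\<close>.\<close>
    have "?closed \<longleftrightarrow> a34 = - d * a12 \<and>
        3 * d / 2 * a13 = 1 * a23 \<and> 3 * d / 2 * a23 = - 1 * a13"
      unfolding D by (intro iffI conjI; elim conjE; linarith)
    then show "?closed \<longleftrightarrow> closed_coeffs g a12 a13 a14 a23 a24 a34"
      unfolding rotation_system_iff[OF one_neq_zero] by (auto simp: D4p)
  next
    case H4
    have D: "?D (e 1) (e 2) (e 3) = 0" "?D (e 1) (e 2) (e 4) = - a34 - a12"
      "?D (e 1) (e 3) (e 4) = - 3 / 2 * a13" "?D (e 2) (e 3) (e 4) = - a13 - 3 / 2 * a23"
      by (simp_all add: brackets[unfolded H4, simplified] flip eval)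
    show "?closed \<longleftrightarrow> closed_coeffs g a12 a13 a14 a23 a24 a34"
      by (auto simp: H4 D)
  qed
qed

section \<open>Reduction to six real coefficients\<close>

lemma symplectic_form_coeffs:
  assumes "has_brackets br e g" "admissible g"
  shows "symplectic_form br \<omega> \<longleftrightarrow> two_form \<omega> \<and>
    closed_coeffs g (\<omega> (e 1) (e 2)) (\<omega> (e 1) (e 3)) (\<omega> (e 1) (e 4))
      (\<omega> (e 2) (e 3)) (\<omega> (e 2) (e 4)) (\<omega> (e 3) (e 4)) \<and>
    \<omega> (e 1) (e 2) * \<omega> (e 3) (e 4) - \<omega> (e 1) (e 3) * \<omega> (e 2) (e 4)
      + \<omega> (e 1) (e 4) * \<omega> (e 2) (e 3) \<noteq> 0"
  unfolding symplectic_form_iff[OF br basis] pfaffian_def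
  using cocycle_defect_basis_iff[OF assms, of \<omega>] by blast

end

text \<open>The Pfaffian has one product for each splitting of the four indices into two pairs. It
  vanishes identically when closedness costs every product a factor; otherwise a form supported on a
  single splitting is a witness.\<close>

lemma ex_closed_coeffs_iff:
  assumes "admissible g"
  shows "(\<exists>a12 a13 a14 a23 a24 a34. closed_coeffs g a12 a13 a14 a23 a24 a34 \<and>
      a12 * a34 - a13 * a24 + a14 * a23 \<noteq> 0) \<longleftrightarrow>
    g = A4 \<or>
    g = RH3 \<or> g = RR3_par 0 \<or> g = RR3_par (-1) \<or> g = RR3p 0 \<or> g = R2R2 \<or> g = R2p \<or>
    g = N4 \<or> g = R4_mu 0 \<or> g = R4_mu (-1) \<or>
    (\<exists>\<beta>. g = R4_ab (-1) \<beta> \<and> \<beta> \<notin> {-1, 0, 1}) \<or>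
    g = R4_ab (-1) (-1) \<or> g = R4_ab (-1) 1 \<or>
    (\<exists>\<alpha>. g = R4_ab \<alpha> (-\<alpha>) \<and> \<alpha> \<notin> {-1, 0}) \<or>
    (\<exists>\<delta>. g = R4p 0 \<delta> \<and> \<delta> \<noteq> 0) \<or>
    g = D4_par 1 \<or> g = D4_par 2 \<or> (\<exists>l. g = D4_par l \<and> l \<notin> {1, 2}) \<or>
    (\<exists>\<delta>. g = D4p \<delta> \<and> \<delta> \<noteq> 0) \<or> g = H4"
    (is "(\<exists>a12 a13 a14 a23 a24 a34. ?P a12 a13 a14 a23 a24 a34) \<longleftrightarrow> ?list")
proof
  assume ?list
  \<comment> \<open>A sign is reversed where closedness ties a pair together:
    \<open>a24 = - a13\<close> for \<open>R2p\<close>, \<open>a34 = - a12\<close> for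
    \<open>D4_par\<close> and \<open>H4\<close>. For \<open>D4p d\<close> the tie
    \<open>a34 = - d * a12\<close> depends on \<open>d\<close>, hence the separate case.\<close>
  then consider "?P 1 0 0 0 0 1" | "?P 0 1 0 0 1 0" | "?P 0 0 1 1 0 0" | "?P 0 1 0 0 (-1) 0"
    | "?P 1 0 0 0 0 (-1)" | d where "g = D4p d" "d \<noteq> 0"
    by (elim disjE exE conjE; simp)
  then show "\<exists>a12 a13 a14 a23 a24 a34. ?P a12 a13 a14 a23 a24 a34"
  proof cases
    case (6 d)
    then have "?P 1 0 0 0 0 (- d)" by simp
    then show ?thesis by blast
  qed blast+
next
  assume "\<exists>a12 a13 a14 a23 a24 a34. ?P a12 a13 a14 a23 a24 a34"
  then show ?list
    \<comment> \<open>For \<open>R4_ab a b\<close>, admissibility turns \<open>b = -1\<close> into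
      \<open>a = -1\<close> and excludes zero parameters; for \<open>R4p\<close> it gives
      \<open>\<delta> \<noteq> 0\<close>.\<close>
    using assms by (cases g) (auto simp: add_eq_0_iff)
qed

text \<open>Both sides of each normal form equivalence become conditions on the six coefficients.
  \<open>A4\<close> is listed because every 2-form on the abelian algebra is closed. For
  \<open>D4_par 2\<close>, closedness makes the Pfaffian \<open>a14 * a23 - a\<^sup>2\<close>,
  whence the sign in its condition.\<close>

theorem proposition4p2:
  fixes br :: "'a::real_vector \<Rightarrow> 'a \<Rightarrow> 'a"
    and e :: "nat \<Rightarrow> 'a"
    and g :: lie4
    and E :: "nat \<Rightarrow> nat \<Rightarrow> 'a \<Rightarrow> 'a \<Rightarrow> real"
  assumes "lie_bracket br" and "lie_solvable br"
    and "basis4 e" and "admissible g" and "has_brackets br e g"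
    and E: "\<And>i j. E i j = wedge_1_1 (dual_basis e i) (dual_basis e j)"
  shows
    "((\<exists>\<omega>. symplectic_form br \<omega>) \<longleftrightarrow>
        g = A4 \<or>
        g = RH3 \<or> g = RR3_par 0 \<or> g = RR3_par (-1) \<or> g = RR3p 0 \<or> g = R2R2 \<or> g = R2p \<or>
        g = N4 \<or> g = R4_mu 0 \<or> g = R4_mu (-1) \<or>
        (\<exists>\<beta>. g = R4_ab (-1) \<beta> \<and> \<beta> \<notin> {-1, 0, 1}) \<or>
        g = R4_ab (-1) (-1) \<or> g = R4_ab (-1) 1 \<or>
        (\<exists>\<alpha>. g = R4_ab \<alpha> (-\<alpha>) \<and> \<alpha> \<notin> {-1, 0}) \<or>
        (\<exists>\<delta>. g = R4p 0 \<delta> \<and> \<delta> \<noteq> 0) \<or>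
        g = D4_par 1 \<or> g = D4_par 2 \<or> (\<exists>l. g = D4_par l \<and> l \<notin> {1, 2}) \<or>
        (\<exists>\<delta>. g = D4p \<delta> \<and> \<delta> \<noteq> 0) \<or> g = H4)
   \<and> (g = RH3 \<longrightarrow> (\<forall>\<omega>. symplectic_form br \<omega> \<longleftrightarrow> (\<exists>a12 a13 a14 a23 a24.
        \<omega> = (\<lambda>X Y. a12 * E 1 2 X Y + a13 * E 1 3 X Y + a14 * E 1 4 X Y
               + a23 * E 2 3 X Y + a24 * E 2 4 X Y) \<and>
        a14 * a23 - a13 * a24 \<noteq> 0)))
   \<and> (g = RR3_par 0 \<longrightarrow> (\<forall>\<omega>. symplectic_form br \<omega> \<longleftrightarrow> (\<exists>a12 a13 a14 a34.
        \<omega> = (\<lambda>X Y. a12 * E 1 2 X Y + a13 * E 1 3 X Y + a14 * E 1 4 X Y + a34 * E 3 4 X Y) \<and>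
        a12 * a34 \<noteq> 0)))
   \<and> (g = RR3_par (-1) \<longrightarrow> (\<forall>\<omega>. symplectic_form br \<omega> \<longleftrightarrow> (\<exists>a12 a13 a14 a23.
        \<omega> = (\<lambda>X Y. a12 * E 1 2 X Y + a13 * E 1 3 X Y + a14 * E 1 4 X Y + a23 * E 2 3 X Y) \<and>
        a14 * a23 \<noteq> 0)))
   \<and> (g = RR3p 0 \<longrightarrow> (\<forall>\<omega>. symplectic_form br \<omega> \<longleftrightarrow> (\<exists>a12 a13 a14 a23.
        \<omega> = (\<lambda>X Y. a12 * E 1 2 X Y + a13 * E 1 3 X Y + a14 * E 1 4 X Y + a23 * E 2 3 X Y) \<and>
        a14 * a23 \<noteq> 0)))
   \<and> (g = R2R2 \<longrightarrow> (\<forall>\<omega>. symplectic_form br \<omega> \<longleftrightarrow> (\<exists>a12 a13 a34.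
        \<omega> = (\<lambda>X Y. a12 * E 1 2 X Y + a13 * E 1 3 X Y + a34 * E 3 4 X Y) \<and>
        a12 * a34 \<noteq> 0)))
   \<and> (g = R2p \<longrightarrow> (\<forall>\<omega>. symplectic_form br \<omega> \<longleftrightarrow> (\<exists>a12 a b.
        \<omega> = (\<lambda>X Y. a12 * E 1 2 X Y + a * (E 1 3 X Y - E 2 4 X Y)
               + b * (E 1 4 X Y + E 2 3 X Y)) \<and>
        a\<^sup>2 + b\<^sup>2 \<noteq> 0)))
   \<and> (g = N4 \<longrightarrow> (\<forall>\<omega>. symplectic_form br \<omega> \<longleftrightarrow> (\<exists>a12 a14 a24 a34.
        \<omega> = (\<lambda>X Y. a12 * E 1 2 X Y + a14 * E 1 4 X Y + a24 * E 2 4 X Y + a34 * E 3 4 X Y) \<and>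
        a12 * a34 \<noteq> 0)))
   \<and> (g = R4_mu 0 \<longrightarrow> (\<forall>\<omega>. symplectic_form br \<omega> \<longleftrightarrow> (\<exists>a14 a23 a24 a34.
        \<omega> = (\<lambda>X Y. a14 * E 1 4 X Y + a23 * E 2 3 X Y + a24 * E 2 4 X Y + a34 * E 3 4 X Y) \<and>
        a14 * a23 \<noteq> 0)))
   \<and> (g = R4_mu (-1) \<longrightarrow> (\<forall>\<omega>. symplectic_form br \<omega> \<longleftrightarrow> (\<exists>a13 a14 a24 a34.
        \<omega> = (\<lambda>X Y. a13 * E 1 3 X Y + a14 * E 1 4 X Y + a24 * E 2 4 X Y + a34 * E 3 4 X Y) \<and>
        a13 * a24 \<noteq> 0)))
   \<and> (\<forall>\<beta>. g = R4_ab (-1) \<beta> \<and> \<beta> \<notin> {-1, 0, 1} \<longrightarrow>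
        (\<forall>\<omega>. symplectic_form br \<omega> \<longleftrightarrow> (\<exists>a12 a14 a24 a34.
        \<omega> = (\<lambda>X Y. a12 * E 1 2 X Y + a14 * E 1 4 X Y + a24 * E 2 4 X Y + a34 * E 3 4 X Y) \<and>
        a12 * a34 \<noteq> 0)))
   \<and> (g = R4_ab (-1) (-1) \<longrightarrow> (\<forall>\<omega>. symplectic_form br \<omega> \<longleftrightarrow> (\<exists>a12 a13 a14 a24 a34.
        \<omega> = (\<lambda>X Y. a12 * E 1 2 X Y + a13 * E 1 3 X Y + a14 * E 1 4 X Y
               + a24 * E 2 4 X Y + a34 * E 3 4 X Y) \<and>
        a12 * a34 - a13 * a24 \<noteq> 0)))
   \<and> (g = R4_ab (-1) 1 \<longrightarrow> (\<forall>\<omega>. symplectic_form br \<omega> \<longleftrightarrow> (\<exists>a12 a14 a23 a24 a34.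
        \<omega> = (\<lambda>X Y. a12 * E 1 2 X Y + a14 * E 1 4 X Y + a23 * E 2 3 X Y
               + a24 * E 2 4 X Y + a34 * E 3 4 X Y) \<and>
        a12 * a34 + a14 * a23 \<noteq> 0)))
   \<and> (\<forall>\<alpha>. g = R4_ab \<alpha> (-\<alpha>) \<and> \<alpha> \<notin> {-1, 0} \<longrightarrow>
        (\<forall>\<omega>. symplectic_form br \<omega> \<longleftrightarrow> (\<exists>a14 a23 a24 a34.
        \<omega> = (\<lambda>X Y. a14 * E 1 4 X Y + a23 * E 2 3 X Y + a24 * E 2 4 X Y + a34 * E 3 4 X Y) \<and>
        a14 * a23 \<noteq> 0)))
   \<and> (\<forall>\<delta>. g = R4p 0 \<delta> \<and> \<delta> \<noteq> 0 \<longrightarrow>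
        (\<forall>\<omega>. symplectic_form br \<omega> \<longleftrightarrow> (\<exists>a14 a23 a24 a34.
        \<omega> = (\<lambda>X Y. a14 * E 1 4 X Y + a23 * E 2 3 X Y + a24 * E 2 4 X Y + a34 * E 3 4 X Y) \<and>
        a14 * a23 \<noteq> 0)))
   \<and> (g = D4_par 1 \<longrightarrow> (\<forall>\<omega>. symplectic_form br \<omega> \<longleftrightarrow> (\<exists>a a14 a24.
        \<omega> = (\<lambda>X Y. a * (E 1 2 X Y - E 3 4 X Y) + a14 * E 1 4 X Y + a24 * E 2 4 X Y) \<and>
        a \<noteq> 0)))
   \<and> (g = D4_par 2 \<longrightarrow> (\<forall>\<omega>. symplectic_form br \<omega> \<longleftrightarrow> (\<exists>a a14 a23 a24.
        \<omega> = (\<lambda>X Y. a * (E 1 2 X Y - E 3 4 X Y) + a14 * E 1 4 X Y + a23 * E 2 3 X Y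
               + a24 * E 2 4 X Y) \<and>
        a\<^sup>2 - a14 * a23 \<noteq> 0)))
   \<and> (\<forall>l. g = D4_par l \<and> l \<notin> {1, 2} \<longrightarrow>
        (\<forall>\<omega>. symplectic_form br \<omega> \<longleftrightarrow> (\<exists>a a14 a24.
        \<omega> = (\<lambda>X Y. a * (E 1 2 X Y - E 3 4 X Y) + a14 * E 1 4 X Y + a24 * E 2 4 X Y) \<and>
        a \<noteq> 0)))
   \<and> (\<forall>\<delta>. g = D4p \<delta> \<and> \<delta> \<noteq> 0 \<longrightarrow>
        (\<forall>\<omega>. symplectic_form br \<omega> \<longleftrightarrow> (\<exists>a a14 a24.
        \<omega> = (\<lambda>X Y. a * (- E 1 2 X Y + \<delta> * E 3 4 X Y) + a14 * E 1 4 X Y + a24 * E 2 4 X Y) \<and>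
        a \<noteq> 0)))
   \<and> (g = H4 \<longrightarrow> (\<forall>\<omega>. symplectic_form br \<omega> \<longleftrightarrow> (\<exists>a a14 a24.
        \<omega> = (\<lambda>X Y. a * (E 1 2 X Y - E 3 4 X Y) + a14 * E 1 4 X Y + a24 * E 2 4 X Y) \<and>
        a \<noteq> 0)))"
proof -
  interpret lie_frame br e
    using assms(1,3) by unfold_locales
  note symp = symplectic_form_coeffs[OF assms(5,4)]
  have ex: "(\<exists>\<omega>. symplectic_form br \<omega>) \<longleftrightarrow>
      (\<exists>a12 a13 a14 a23 a24 a34. closed_coeffs g a12 a13 a14 a23 a24 a34 \<and>
        a12 * a34 - a13 * a24 + a14 * a23 \<noteq> 0)"
    unfolding symp by (rule ex_two_form_iff)
  \<comment> \<open>For \<open>D4p\<close> the parameter is determined by an equation with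
    \<open>- a\<close>; this acts as a one-point rule for it.\<close>
  have ex_eq_minus_iff: "(\<exists>a. x = - a \<and> P a) \<longleftrightarrow> P (- x)" for x :: real and P
    by (metis minus_minus)
  note normal_form = symp E two_form_eq_iff[OF basis] two_form_intros E_basis power2_eq_square
  show ?thesis
    unfolding ex ex_closed_coeffs_iff[OF assms(4)]
    \<comment> \<open>For \<open>R4_ab \<alpha> (-\<alpha>)\<close>, the bound
      \<open>\<alpha> \<le> -\<alpha>\<close> excludes \<open>\<alpha> = 1\<close>, where
      \<open>a13\<close> would stay free.\<close>
    using assms(4)
    by (intro conjI impI allI refl)
       (auto simp: normal_form add_eq_0_iff ex_eq_minus_iff)
qed

end
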